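(* Let $C_n$ be an even cycle (so $n\ge 4$ is even). Then $C_n$ is injectively fall colorable if and only if either $n\equiv0\pmod 4$ or $n\equiv6\pmod{12}$. In addition, $C_n$ is perfect injectively colorable if and only if $n\equiv 0\pmod 4$ or $n=6$. Also, $C_n$ is injectively fall $\chi_i(C_{n})$-colorable if and only if $n\equiv0\pmod 4$ or $n\equiv6\pmod{12}$.
   Context: An injective $k$-coloring function of a finite simple graph $G$ is a function $f:V(G)\to\{1,\dots,k\}$ such that no vertex $v$ is adjacent to two distinct vertices $u$ and $w$ with $f(u)=f(w)$ (adjacent vertices may receive the same color); the partition of $V(G)$ into its color classes is an injective coloring. The injective chromatic number $\chi_i(G)$ is the minimum $k$ for which $G$ admits an injective $k$-coloring function. An open packing in $G$ is a set $B\subseteq V(G)$ such that $N_G(u)\cap N_G(v)=\emptyset$ for any two distinct $u,v\in B$; it is maximal if adding any new vertex to it yields a set that is not an open packing. The open packing number $\rho^{\rm o}(G)$ is the maximum cardinality of an open packing in $G$. $G$ is perfect injectively colorable if it has an injective coloring in which every color class is an open packing of cardinality $\rho^{\rm o}(G)$. An injective fall coloring of $G$ is a partition of $V(G)$ into maximal open packings. $G$ is injectively fall colorable if it admits an injective fall coloring, and injectively fall $\chi_i(G)$-colorable if it admits an injective fall coloring with exactly $\chi_i(G)$ classes. *)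

theory Defs
  imports
    "Graph_Theory.Pair_Digraph"
    "HOL-Library.Disjoint_Sets"
    "HOL-Number_Theory.Cong"
begin

text \<open>
  Finite simple graphs are the structures satisfying \<^locale>\<open>pair_graph\<close>: finite, symmetric,
  loop-free arc relations. An undirected edge is represented by its two arcs.
\<close>

definition nbhd :: "'a pair_pre_digraph \<Rightarrow> 'a \<Rightarrow> 'a set" where
  "nbhd G u = {v. (u, v) \<in> parcs G}"

definition injective_coloring_fun :: "'a pair_pre_digraph \<Rightarrow> nat \<Rightarrow> ('a \<Rightarrow> nat) \<Rightarrow> bool" where
  "injective_coloring_fun G k f \<longleftrightarrow>
     f ` pverts G \<subseteq> {1..k} \<and>
     (\<forall>v \<in> pverts G. \<forall>u \<in> nbhd G v. \<forall>w \<in> nbhd G v. u \<noteq> w \<longrightarrow> f u \<noteq> f w)"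

text \<open>Only colors that occur contribute a class, so the classes are the blocks of a partition.\<close>

definition color_classes :: "'a pair_pre_digraph \<Rightarrow> ('a \<Rightarrow> nat) \<Rightarrow> 'a set set" where
  "color_classes G f = (\<lambda>c. {v \<in> pverts G. f v = c}) ` (f ` pverts G)"

definition injective_coloring :: "'a pair_pre_digraph \<Rightarrow> 'a set set \<Rightarrow> bool" where
  "injective_coloring G P \<longleftrightarrow> (\<exists>k f. injective_coloring_fun G k f \<and> P = color_classes G f)"

definition injective_chromatic_number :: "'a pair_pre_digraph \<Rightarrow> nat" where
  "injective_chromatic_number G = (LEAST k. \<exists>f. injective_coloring_fun G k f)"

definition open_packing :: "'a pair_pre_digraph \<Rightarrow> 'a set \<Rightarrow> bool" where
  "open_packing G B \<longleftrightarrow>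
     B \<subseteq> pverts G \<and> (\<forall>u \<in> B. \<forall>v \<in> B. u \<noteq> v \<longrightarrow> nbhd G u \<inter> nbhd G v = {})"

definition maximal_open_packing :: "'a pair_pre_digraph \<Rightarrow> 'a set \<Rightarrow> bool" where
  "maximal_open_packing G B \<longleftrightarrow>
     open_packing G B \<and> (\<forall>v \<in> pverts G - B. \<not> open_packing G (insert v B))"

definition open_packing_number :: "'a pair_pre_digraph \<Rightarrow> nat" where
  "open_packing_number G = Max {card B | B. open_packing G B}"

definition perfect_injectively_colorable :: "'a pair_pre_digraph \<Rightarrow> bool" where
  "perfect_injectively_colorable G \<longleftrightarrow>
     (\<exists>P. injective_coloring G P \<and>
          (\<forall>B \<in> P. open_packing G B \<and> card B = open_packing_number G))"

definition injective_fall_coloring :: "'a pair_pre_digraph \<Rightarrow> 'a set set \<Rightarrow> bool" where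
  "injective_fall_coloring G P \<longleftrightarrow>
     partition_on (pverts G) P \<and> (\<forall>B \<in> P. maximal_open_packing G B)"

definition injectively_fall_colorable :: "'a pair_pre_digraph \<Rightarrow> bool" where
  "injectively_fall_colorable G \<longleftrightarrow> (\<exists>P. injective_fall_coloring G P)"

definition injectively_fall_chi_colorable :: "'a pair_pre_digraph \<Rightarrow> bool" where
  "injectively_fall_chi_colorable G \<longleftrightarrow>
     (\<exists>P. injective_fall_coloring G P \<and> card P = injective_chromatic_number G)"

definition cycle_graph :: "nat \<Rightarrow> nat pair_pre_digraph" where
  "cycle_graph n =
     \<lparr> pverts = {..<n},
       parcs = {(i, j). i < n \<and> j < n \<and> (j = (i + 1) mod n \<or> i = (j + 1) mod n)} \<rparr>"

lemma pair_graph_cycle_graph: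
  assumes "n \<ge> 3"
  shows "pair_graph (cycle_graph n)"
proof
  have "parcs (cycle_graph n) \<subseteq> {..<n} \<times> {..<n}"
    by (auto simp: cycle_graph_def)
  then show "finite (parcs (cycle_graph n))"
    by (rule finite_subset) simp
  show "symmetric (with_proj (cycle_graph n))"
    by (auto simp: symmetric_def cycle_graph_def sym_def)
  show "fst e \<noteq> snd e" if "e \<in> parcs (cycle_graph n)" for e
    using that assms by (auto simp: cycle_graph_def mod_Suc split: if_splits)
qed (auto simp: cycle_graph_def)

end

theory Submission
  imports Defs
begin

text \<open>
  Two distinct vertices of the cycle have a common neighbour iff they differ by \<open>2\<close> modulo \<open>n\<close>.
  Hence open packings are the independent sets of the translation graph \<open>u \<mapsto> u + 2\<close>, which for
  even \<open>n\<close> is a disjoint union of two cycles of length \<open>m = n / 2\<close>, and injective fall colorings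
  are fall colorings of that graph. A vertex sees all other classes among its two neighbours
  \<open>u \<plusminus> 2\<close>, so there are two or three classes. Two classes alternate, so \<open>m\<close> is even; three
  classes repeat with period three, so \<open>3\<close> divides \<open>m\<close>. Conversely \<open>u \<mapsto> (u div 2) mod r\<close> is a
  fall coloring whenever \<open>r \<in> {2, 3}\<close> divides \<open>m\<close>. Finally the open packing number is \<open>m\<close> for
  even \<open>m\<close> and \<open>m - 1\<close> for odd \<open>m\<close>, and \<open>m - 1\<close> divides \<open>2 m\<close> only for \<open>m \<le> 3\<close>.
\<close>

section \<open>Translation of the notions to the shift by two\<close>

lemma pverts_cycle [simp]: "pverts (cycle_graph n) = {..<n}"
  by (simp add: cycle_graph_def)

text \<open>A common neighbour is the successor of one vertex and the predecessor of the other: were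
  it the successor, or the predecessor, of both, injectivity of the successor map would force
  \<open>u = v\<close>.\<close>

lemma cycle_common_neighbour_iff:
  assumes "n \<ge> 3" "u < n" "v < n" "u \<noteq> v"
  shows "nbhd (cycle_graph n) u \<inter> nbhd (cycle_graph n) v \<noteq> {} \<longleftrightarrow>
         v = (u + 2) mod n \<or> u = (v + 2) mod n"
proof -
  have two: "(Suc (x mod n)) mod n = Suc x mod n" for x
    by (simp add: mod_simps)
  have inj: "x = y" if "Suc x mod n = Suc y mod n" "x < n" "y < n" for x y
    using that by (auto simp: mod_Suc split: if_splits)
  have mem: "w \<in> nbhd (cycle_graph n) x \<longleftrightarrow> w < n \<and> (w = Suc x mod n \<or> x = Suc w mod n)"
    if "x < n" for x w
    using that by (auto simp: nbhd_def cycle_graph_def)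
  show ?thesis
  proof
    assume "nbhd (cycle_graph n) u \<inter> nbhd (cycle_graph n) v \<noteq> {}"
    then obtain w where w: "w < n" "w = Suc u mod n \<or> u = Suc w mod n"
        "w = Suc v mod n \<or> v = Suc w mod n"
      using mem assms by auto
    then show "v = (u + 2) mod n \<or> u = (v + 2) mod n"
      using inj assms two by (metis add_2_eq_Suc')
  next
    assume a: "v = (u + 2) mod n \<or> u = (v + 2) mod n"
    have "Suc u mod n < n" "Suc v mod n < n" using assms by auto
    then have "Suc u mod n \<in> nbhd (cycle_graph n) u \<inter> nbhd (cycle_graph n) v \<or>
        Suc v mod n \<in> nbhd (cycle_graph n) u \<inter> nbhd (cycle_graph n) v"
      using a mem assms two by (auto simp: mod_simps)
    then show "nbhd (cycle_graph n) u \<inter> nbhd (cycle_graph n) v \<noteq> {}" by blast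
  qed
qed

lemma add_2_mod_neq:
  fixes u n :: nat
  assumes "n \<ge> 3" "u < n"
  shows "(u + 2) mod n \<noteq> u"
  using assms by (cases "u + 2 < n") (auto simp: mod_if)

lemma inj_on_add_2_mod:
  "inj_on (\<lambda>u. (u + 2) mod n) {..<n :: nat}"
proof (rule inj_onI)
  fix x y assume *: "x \<in> {..<n}" "y \<in> {..<n}" "(x + 2) mod n = (y + 2) mod n"
  from *(3) have "[x = y] (mod n)"
    using cong_add_rcancel_nat[of x 2 y n] by (simp add: cong_def)
  then show "x = y" using * by (simp add: cong_def)
qed

text \<open>Testing forward shifts is enough, since the backward condition at \<open>u\<close> is
  the forward one at \<open>v\<close>. Distinctness is automatic by
  \<open>add_2_mod_neq\<close>.\<close>

lemma open_packing_cycle_iff: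
  assumes "n \<ge> 3"
  shows "open_packing (cycle_graph n) B \<longleftrightarrow> B \<subseteq> {..<n} \<and> (\<forall>u\<in>B. (u + 2) mod n \<notin> B)"
proof (cases "B \<subseteq> {..<n}")
  case True
  have "open_packing (cycle_graph n) B \<longleftrightarrow>
      (\<forall>u\<in>B. \<forall>v\<in>B. u \<noteq> v \<longrightarrow> \<not> (v = (u + 2) mod n \<or> u = (v + 2) mod n))"
  proof -
    have "nbhd (cycle_graph n) u \<inter> nbhd (cycle_graph n) v = {} \<longleftrightarrow>
        \<not> (v = (u + 2) mod n \<or> u = (v + 2) mod n)" if "u \<in> B" "v \<in> B" "u \<noteq> v" for u v
      using cycle_common_neighbour_iff[OF assms] True that by blast
    then show ?thesis using True unfolding open_packing_def pverts_cycle by blast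
  qed
  also have "\<dots> \<longleftrightarrow> (\<forall>u\<in>B. (u + 2) mod n \<notin> B)"
  proof -
    have "u \<noteq> (u + 2) mod n" if "u \<in> B" for u
      using add_2_mod_neq[OF assms, of u] True that by auto
    then show ?thesis by blast
  qed
  finally show ?thesis using True by simp
qed (simp add: open_packing_def)

lemma maximal_open_packing_cycle_iff:
  assumes "n \<ge> 3"
  shows "maximal_open_packing (cycle_graph n) B \<longleftrightarrow> open_packing (cycle_graph n) B \<and>
    (\<forall>v<n. v \<notin> B \<longrightarrow> (v + 2) mod n \<in> B \<or> (\<exists>u\<in>B. (u + 2) mod n = v))"
  unfolding maximal_open_packing_def
  using open_packing_cycle_iff[OF assms] add_2_mod_neq[OF assms] by auto

lemma injective_coloring_fun_cycle_iff:
  assumes "n \<ge> 3"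
  shows "injective_coloring_fun (cycle_graph n) k f \<longleftrightarrow>
    f ` {..<n} \<subseteq> {1..k} \<and> (\<forall>u<n. f u \<noteq> f ((u + 2) mod n))"
proof -
  have mem: "v \<in> nbhd (cycle_graph n) u \<and> u < n \<longleftrightarrow> u \<in> nbhd (cycle_graph n) v \<and> v < n" for u v
    by (auto simp: nbhd_def cycle_graph_def)
  have lt: "v < n" if "v \<in> nbhd (cycle_graph n) u" for u v
    using that by (auto simp: nbhd_def cycle_graph_def)
  \<comment> \<open>Symmetry of adjacency turns quantification over the middle vertex into
    quantification over pairs with a common neighbour.\<close>
  have "(\<forall>v\<in>{..<n}. \<forall>u\<in>nbhd (cycle_graph n) v. \<forall>w\<in>nbhd (cycle_graph n) v. u \<noteq> w \<longrightarrow> f u \<noteq> f w) \<longleftrightarrow>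
    (\<forall>u<n. \<forall>w<n. u \<noteq> w \<longrightarrow> nbhd (cycle_graph n) u \<inter> nbhd (cycle_graph n) w \<noteq> {} \<longrightarrow> f u \<noteq> f w)"
    using mem lt by blast
  also have "\<dots> \<longleftrightarrow> (\<forall>u<n. \<forall>w<n. u \<noteq> w \<longrightarrow> w = (u + 2) mod n \<or> u = (w + 2) mod n \<longrightarrow> f u \<noteq> f w)"
    using cycle_common_neighbour_iff[OF assms] by blast
  also have "\<dots> \<longleftrightarrow> (\<forall>u<n. f u \<noteq> f ((u + 2) mod n))"
  proof -
    have "(u + 2) mod n < n \<and> u \<noteq> (u + 2) mod n" if "u < n" for u
      using add_2_mod_neq[OF assms that] assms by simp
    then show ?thesis by metis
  qed
  finally show ?thesis
    unfolding injective_coloring_fun_def pverts_cycle by (rule conj_cong[OF refl])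
qed

section \<open>Necessity for fall colorings\<close>

text \<open>The shift orbit of \<open>0\<close> closes after \<open>n div 2\<close> steps, an odd
  number, so no predicate can flip at every step. This parity obstruction also drives the bounds on
  packings and on two-colorings.\<close>

lemma not_alternating:
  assumes "n mod 4 = 2"
  obtains u :: nat where "u < n" "Q u \<longleftrightarrow> Q ((u + 2) mod n)"
proof -
  have n: "n > 0" using assms by (cases n) auto
  have step: "(2 * j mod n + 2) mod n = 2 * Suc j mod n" for j
    by (simp add: mod_simps)
  have False if alt: "\<And>u. u < n \<Longrightarrow> Q u \<noteq> Q ((u + 2) mod n)"
  proof -
    have *: "Q (2 * j mod n) = (Q 0 = even j)" for j
    proof (induction j)
      case (Suc j)
      then show ?case
        using alt[of "2 * j mod n"] n step[of j] by auto
    qed simp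
    have "odd (n div 2)" "2 * (n div 2) = n" using assms by presburger+
    then show False using *[of "n div 2"] by auto
  qed
  then show ?thesis using that by blast
qed

lemma fall_colorable_cycle_imp:
  assumes n: "n \<ge> 3" and n2: "n mod 4 = 2" and P: "injective_fall_coloring (cycle_graph n) P"
  shows "n mod 12 = 6"
proof -
  have part: "partition_on {..<n} P"
    and mx: "\<And>B. B \<in> P \<Longrightarrow> maximal_open_packing (cycle_graph n) B"
    using P by (auto simp: injective_fall_coloring_def)
  have step: "(2 * j mod n + 2) mod n = 2 * Suc j mod n" for j
    by (simp add: mod_simps)
  have uniq: "B = C" if "B \<in> P" "C \<in> P" "x \<in> B" "x \<in> C" for B C x
    using part that unfolding partition_on_def disjoint_def by blast
  have ex: "\<exists>B\<in>P. x \<in> B" if "x < n" for x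
    using part that unfolding partition_on_def by blast
  have "\<forall>j. \<exists>B. B \<in> P \<and> 2 * j mod n \<in> B"
  proof
    fix j
    have "2 * j mod n < n" using n by simp
    then show "\<exists>B. B \<in> P \<and> 2 * j mod n \<in> B" using ex by blast
  qed
  \<comment> \<open>The classes met along the shift orbit of \<open>0\<close>, indexed by all
    naturals so that wrapping around becomes a periodicity of \<open>c\<close>.\<close>
  then obtain c where c: "c j \<in> P" "2 * j mod n \<in> c j" for j
    by metis
  have nxt: "(u + 2) mod n \<notin> B" if "B \<in> P" "u \<in> B" for B u
    using mx[OF that(1)] that(2) n
    by (auto simp: maximal_open_packing_cycle_iff open_packing_cycle_iff)
  have c1: "c j \<noteq> c (Suc j)" for j
    using nxt[OF c(1,2)] c(2) step by metis
  \<comment> \<open>Maximality at the middle vertex \<open>2 * Suc j mod n\<close>: a class that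
    misses it contains one of its two shift neighbours.\<close>
  have sees: "B = c j \<or> B = c (j + 1) \<or> B = c (j + 2)" if "B \<in> P" for B j
  proof (cases "2 * Suc j mod n \<in> B")
    case True
    then show ?thesis using uniq[OF that c(1) _ c(2)] by auto
  next
    case False
    have lt: "x mod n < n" for x using n by simp
    from False mx[OF that] consider "(2 * Suc j mod n + 2) mod n \<in> B"
      | u where "u \<in> B" "(u + 2) mod n = 2 * Suc j mod n"
      using lt unfolding maximal_open_packing_cycle_iff[OF n] by blast
    then show ?thesis
    proof cases
      case 1
      then have "2 * Suc (Suc j) mod n \<in> B" using step by metis
      then show ?thesis using uniq[OF that c(1) _ c(2)] by simp
    next
      case 2
      have "u < n" using 2 mx[OF that]
        by (auto simp: maximal_open_packing_def open_packing_def)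
      then have "u = 2 * j mod n"
        using inj_on_add_2_mod[of n] 2 step[of j] lt unfolding inj_on_def by (metis lessThan_iff)
      then show ?thesis using 2 uniq[OF that c(1) _ c(2)] by auto
    qed
  qed
  \<comment> \<open>A coincidence leaves only two classes. By \<open>not_alternating\<close>, some
    \<open>u\<close> and its shift then lie both in \<open>c j\<close> or both in
    \<open>c (j + 1)\<close>, against \<open>nxt\<close>.\<close>
  have c2: "c j \<noteq> c (j + 2)" for j
  proof
    assume "c j = c (j + 2)"
    then have two: "B = c j \<or> B = c (j + 1)" if "B \<in> P" for B
      using sees[OF that, of j] by auto
    obtain u where u: "u < n" "u \<in> c j \<longleftrightarrow> (u + 2) mod n \<in> c j"
      using not_alternating[OF n2, of "\<lambda>u. u \<in> c j"] by blast
    have "(u + 2) mod n < n" using n by simp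
    then show False using u two ex nxt c(1) by metis
  qed
  \<comment> \<open>Among the three classes seen from \<open>j\<close>, the last two are excluded by
    \<open>c1\<close> and \<open>c2\<close>.\<close>
  have c3: "c (j + 3) = c j" for j
    using sees[OF c(1), of "j + 3" j] c1[of "j + 2"] c2[of "j + 1"]
    by (auto simp: numeral_eq_Suc)
  have per: "c (3 * i + r) = c r" for i r
  proof (induction i)
    case (Suc i)
    then show ?case using c3[of "3 * i + r"] by (simp add: algebra_simps)
  qed simp
  have "2 * (n div 2) = n" using n2 by presburger
  \<comment> \<open>The orbit returns to vertex \<open>0\<close> after \<open>n div 2\<close> steps;
    period three then forces 3 to divide that number.\<close>
  then have cm: "c (n div 2) = c 0"
    using uniq[OF c(1) c(1) c(2), of "n div 2" 0] c(2)[of 0] by simp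
  have "3 * (n div 2 div 3) + n div 2 mod 3 = n div 2"
    by (rule mult_div_mod_eq)
  then have c0: "c (n div 2 mod 3) = c 0"
    using per[of "n div 2 div 3" "n div 2 mod 3"] cm by metis
  have "c 1 \<noteq> c 0" "c 2 \<noteq> c 0"
    using c1[of 0] c2[of 0] by (simp_all add: eq_commute numeral_2_eq_2)
  then have "n div 2 mod 3 \<noteq> 1" "n div 2 mod 3 \<noteq> 2"
    using c0 by metis+
  then have "3 dvd n div 2" by presburger
  then obtain k where "n div 2 = 3 * k" by blast
  then have k: "n = 6 * k" using \<open>2 * (n div 2) = n\<close> by simp
  then have "odd k" using n2 by presburger
  then obtain j where "k = 2 * j + 1" by (elim oddE)
  then show ?thesis using k by simp
qed

section \<open>Colorings by residues\<close>

text \<open>For even \<open>n\<close>, \<open>u div 2\<close> is the position of \<open>u\<close> on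
  its shift orbit, so one formula treats the even and the odd orbit alike.\<close>

definition residue_class :: "nat \<Rightarrow> nat \<Rightarrow> nat \<Rightarrow> nat set" where
  "residue_class n r c = {u. u < n \<and> (u div 2) mod r = c}"

text \<open>Reduction modulo \<open>n\<close> subtracts a multiple of \<open>2 * r\<close>, which
  changes the half by a multiple of \<open>r\<close>.\<close>

lemma half_shift_mod:
  fixes n r u :: nat
  assumes "2 * r dvd n"
  shows "((u + 2) mod n) div 2 mod r = (u div 2 + 1) mod r"
proof -
  obtain s where s: "n = 2 * r * s" using assms by blast
  have "(u + 2) mod n + 2 * (r * s * ((u + 2) div n)) = u + 2"
    using mod_mult_div_eq[of "u + 2" n] by (simp add: s mult.assoc)
  then have "(u + 2) div 2 = ((u + 2) mod n) div 2 + r * (s * ((u + 2) div n))"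
    by (metis div_mult_self2 mult.assoc add.commute zero_neq_numeral)
  then have "(u + 2) div 2 mod r = ((u + 2) mod n) div 2 mod r"
    by simp
  then show ?thesis by simp
qed

context
  fixes n r :: nat
  assumes n: "n \<ge> 3" and r: "r = 2 \<or> r = 3" and dvd: "2 * r dvd n"
begin

text \<open>A witness that the classes are nonempty and, later, pairwise distinct.\<close>

lemma double_in_residue_class:
  assumes "c < r"
  shows "2 * c \<in> residue_class n r c"
proof -
  have "2 * r \<le> n" using dvd n by (auto dest: dvd_imp_le)
  then show ?thesis using assms by (simp add: residue_class_def)
qed

lemma add_1_mod_neq: "(x + 1) mod r \<noteq> x mod r"
  using r by (auto simp: mod_Suc)

lemma residue_class_open_packing: "open_packing (cycle_graph n) (residue_class n r c)"
proof -
  have "(u + 2) mod n \<notin> residue_class n r c" if "u \<in> residue_class n r c" for u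
    using that half_shift_mod[OF dvd, of u] add_1_mod_neq[of "u div 2"]
    by (simp add: residue_class_def)
  then show ?thesis
    unfolding open_packing_cycle_iff[OF n] by (auto simp: residue_class_def)
qed

text \<open>Three consecutive positions on an orbit cover all residues modulo 2 or 3, so a class
  missing \<open>v\<close> contains one of its shift neighbours.\<close>

lemma residue_class_maximal:
  assumes "c < r"
  shows "maximal_open_packing (cycle_graph n) (residue_class n r c)"
  unfolding maximal_open_packing_cycle_iff[OF n]
proof (intro conjI allI impI residue_class_open_packing)
  fix v assume v: "v < n" "v \<notin> residue_class n r c"
  have neq: "(v div 2) mod r \<noteq> c" using v by (simp add: residue_class_def)
  \<comment> \<open>The shift predecessor of \<open>v\<close>; adding \<open>n - 2\<close> avoids
    truncated subtraction.\<close>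
  define w where "w = (v + (n - 2)) mod n"
  have w: "w < n" "(w + 2) mod n = v"
  proof -
    have "v + (n - 2) + 2 = v + n" using n by simp
    then show "(w + 2) mod n = v" using v by (simp only: w_def mod_simps) simp
  qed (use n in \<open>simp add: w_def\<close>)
  then have "(w div 2 + 1) mod r = (v div 2) mod r"
    using half_shift_mod[OF dvd, of w] n by simp
  then have "(v div 2 + 1) mod r = c \<or> (w div 2) mod r = c"
  proof -
    obtain a b where ab: "v div 2 mod r = a" "w div 2 mod r = b" by blast
    moreover have "a < r" "b < r" using r by (auto simp flip: ab)
    ultimately show ?thesis
      using \<open>(w div 2 + 1) mod r = (v div 2) mod r\<close> neq r assms
      by (simp add: mod_Suc split: if_splits) arith+
  qed
  then show "(v + 2) mod n \<in> residue_class n r c \<or>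
      (\<exists>u\<in>residue_class n r c. (u + 2) mod n = v)"
    using half_shift_mod[OF dvd, of v] w n by (auto simp: residue_class_def)
qed

lemma inj_on_residue_class: "inj_on (residue_class n r) {..<r}"
  using double_in_residue_class by (fastforce simp: inj_on_def residue_class_def)

lemma residue_class_fall_coloring:
  "injective_fall_coloring (cycle_graph n) (residue_class n r ` {..<r})"
  unfolding injective_fall_coloring_def
proof (intro conjI ballI)
  show "partition_on (pverts (cycle_graph n)) (residue_class n r ` {..<r})"
  proof (rule partition_onI)
    show "\<Union> (residue_class n r ` {..<r}) = pverts (cycle_graph n)"
      using r by (auto simp: residue_class_def)
    show "{} \<notin> residue_class n r ` {..<r}"
      using double_in_residue_class by fastforce
    show "disjnt p q" if "p \<in> residue_class n r ` {..<r}" "q \<in> residue_class n r ` {..<r}" "p \<noteq> q"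
      for p q
      using that by (auto simp: disjnt_def residue_class_def)
  qed
qed (use residue_class_maximal in auto)

text \<open>The added 1 moves the residues into the color range \<open>{1..r}\<close>.\<close>

lemma residue_coloring_fun:
  "injective_coloring_fun (cycle_graph n) r (\<lambda>u. (u div 2) mod r + 1)"
proof -
  have "x mod r + 1 \<le> r" for x using r by (auto simp: Suc_le_eq)
  then show ?thesis
    unfolding injective_coloring_fun_cycle_iff[OF n] half_shift_mod[OF dvd]
    using add_1_mod_neq
    by (metis (no_types, lifting) add_right_cancel atLeastAtMost_iff image_subsetI le_add2)
qed

lemma residue_color_classes:
  "color_classes (cycle_graph n) (\<lambda>u. (u div 2) mod r + 1) = residue_class n r ` {..<r}"
proof -
  \<comment> \<open>\<open>color_classes\<close> ranges over attained colors only, so every residue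
    has to be shown to occur.\<close>
  have "(\<lambda>u. (u div 2) mod r) ` {..<n} = {..<r}"
  proof
    show "{..<r} \<subseteq> (\<lambda>u. (u div 2) mod r) ` {..<n}"
    proof
      fix c assume "c \<in> {..<r}"
      then have "2 * c < n" "c = (2 * c div 2) mod r"
        using double_in_residue_class[of c] by (auto simp: residue_class_def)
      then show "c \<in> (\<lambda>u. (u div 2) mod r) ` {..<n}" by blast
    qed
  qed (use r in auto)
  then have "(\<lambda>c. c + 1) ` (\<lambda>u. (u div 2) mod r) ` {..<n} = (\<lambda>c. c + 1) ` {..<r}"
    by (rule arg_cong)
  then show ?thesis
    by (simp add: color_classes_def residue_class_def image_image lessThan_def)
qed

end

section \<open>Class sizes and the open packing number\<close>

lemma partition_on_sum_card:
  assumes "partition_on A P" "finite A"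
  shows "card A = (\<Sum>B\<in>P. card B)"
proof (rule product_partition[OF assms(1)])
  show "finite B" if "B \<in> P" for B
    using that assms by (auto simp: partition_on_def intro: finite_subset)
qed

lemma partition_on_color_classes: "partition_on (pverts G) (color_classes G f)"
  by (rule partition_onI) (auto simp: color_classes_def disjnt_def)

lemma finite_open_packing_cards:
  assumes "finite (pverts G)"
  shows "finite {card B | B. open_packing G B}"
  by (rule finite_subset[of _ "card ` Pow (pverts G)"])
     (use assms in \<open>auto simp: open_packing_def\<close>)

lemma open_packing_number_ge:
  assumes "finite (pverts G)" "open_packing G B"
  shows "card B \<le> open_packing_number G"
proof -
  show ?thesis
    unfolding open_packing_number_def
    using finite_open_packing_cards[OF assms(1)] assms(2) by (intro Max_ge) auto
qed

lemma open_packing_number_attained: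
  assumes "finite (pverts G)"
  obtains B where "open_packing G B" "card B = open_packing_number G"
proof -
  have "open_packing G {}" by (simp add: open_packing_def)
  then have "open_packing_number G \<in> {card B | B. open_packing G B}"
    unfolding open_packing_number_def
    using finite_open_packing_cards[OF assms] by (intro Max_in) auto
  then show ?thesis using that by auto
qed

text \<open>A packing and its shift are disjoint and equally large. If together they filled the
  cycle, membership would alternate, which \<open>not_alternating\<close> forbids when
  \<open>n mod 4 = 2\<close>.\<close>

lemma open_packing_cycle_card:
  assumes n: "n \<ge> 3" and B: "open_packing (cycle_graph n) B"
  shows "2 * card B \<le> n" and "n mod 4 = 2 \<Longrightarrow> 2 * card B < n"
proof -
  let ?S = "(\<lambda>u. (u + 2) mod n) ` B"
  have B': "B \<subseteq> {..<n}" "B \<inter> ?S = {}"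
    using B n by (auto simp: open_packing_cycle_iff)
  have fin: "finite B" using B'(1) finite_subset by blast
  have cS: "card ?S = card B"
    using inj_on_add_2_mod B'(1) by (meson card_image inj_on_subset)
  have cU: "card (B \<union> ?S) = 2 * card B"
    using card_Un_disjoint[OF fin _ B'(2)] fin cS by simp
  have sub: "B \<union> ?S \<subseteq> {..<n}" using B'(1) n by auto
  show le: "2 * card B \<le> n"
    using card_mono[OF _ sub] cU by simp
  show "2 * card B < n" if n2: "n mod 4 = 2"
  proof (rule ccontr)
    assume "\<not> 2 * card B < n"
    then have eq: "B \<union> ?S = {..<n}"
      using le cU sub by (intro card_subset_eq) auto
    obtain u where u: "u < n" "u \<in> B \<longleftrightarrow> (u + 2) mod n \<in> B"
      using not_alternating[OF n2, of "\<lambda>u. u \<in> B"] by blast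
    have "(u + 2) mod n \<in> B \<union> ?S" using eq n by simp
    then have "u \<in> B"
      using u inj_on_add_2_mod[of n] B'(1) unfolding inj_on_def by blast
    then show False using u B'(2) by auto
  qed
qed

lemma open_packing_number_cycle_odd_half:
  assumes "n = 4 * q + 2" "q > 0"
  shows "open_packing_number (cycle_graph n) = 2 * q"
proof (rule antisym)
  obtain B where "open_packing (cycle_graph n) B" "card B = open_packing_number (cycle_graph n)"
    using open_packing_number_attained[of "cycle_graph n"] by auto
  moreover have "n \<ge> 3" "n mod 4 = 2" using assms by presburger+
  ultimately have "2 * open_packing_number (cycle_graph n) < n"
    using open_packing_cycle_card(2)[of n B] by simp
  then show "open_packing_number (cycle_graph n) \<le> 2 * q"
    using assms(1) by linarith
next
  \<comment> \<open>Enumerates 0, 1, 4, 5, 8, 9, ...: the numbers congruent to 0 or 1 modulo 4. A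
    shift by two leaves these residues, and the first \<open>2 * q\<close> values stay low enough
    that no shift wraps around.\<close>
  define g where "g i = i + 2 * (i div 2)" for i :: nat
  have "inj_on g {..<2 * q}"
  proof (rule linorder_inj_onI')
    fix i j :: nat assume "i < j"
    then have "g i < g j"
      unfolding g_def using div_le_mono[of i j 2] by linarith
    then show "g i \<noteq> g j" by simp
  qed
  then have "card (g ` {..<2 * q}) = 2 * q" by (simp add: card_image)
  moreover have "open_packing (cycle_graph n) (g ` {..<2 * q})"
  proof -
    have lt: "g i + 2 < n" if "i < 2 * q" for i
    proof -
      have "i div 2 < q" "i < 2 * (i div 2) + 2" using that by linarith+
      then show ?thesis unfolding g_def using assms(1) by linarith
    qed
    have "g i mod 4 < 2" for i unfolding g_def by presburger
    moreover have "x + 2 \<noteq> y" if "x mod 4 < 2" "y mod 4 < 2" for x y :: nat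
      using that by presburger
    ultimately have "g i + 2 \<noteq> g j" for i j by blast
    moreover have "(g i + 2) mod n = g i + 2" "g i < n" if "i < 2 * q" for i
      using lt[OF that] by simp_all
    moreover have "n \<ge> 3" using assms by simp
    ultimately show ?thesis
      by (auto simp: open_packing_cycle_iff simp del: add_2_eq_Suc')
  qed
  ultimately show "2 * q \<le> open_packing_number (cycle_graph n)"
    using open_packing_number_ge[of "cycle_graph n" "g ` {..<2 * q}"] by simp
qed

section \<open>Perfect injective colorability\<close>

text \<open>The \<open>r\<close> class sizes sum to \<open>n\<close> and each is at most the packing
  number, so the bound forces equality in every class.\<close>

lemma perfect_cycle_if:
  assumes n: "n \<ge> 3" and r: "r = 2 \<or> r = 3" and dvd: "2 * r dvd n"
    and bound: "r * open_packing_number (cycle_graph n) \<le> n"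
  shows "perfect_injectively_colorable (cycle_graph n)"
  unfolding perfect_injectively_colorable_def
proof (intro exI conjI ballI)
  let ?P = "residue_class n r ` {..<r}"
  let ?\<rho> = "open_packing_number (cycle_graph n)"
  show "injective_coloring (cycle_graph n) ?P"
    unfolding injective_coloring_def
    using residue_coloring_fun[OF n r dvd] residue_color_classes[OF n r dvd] by metis
  show op: "open_packing (cycle_graph n) B" if "B \<in> ?P" for B
    using that residue_class_open_packing[OF n r dvd] by auto
  have "n = (\<Sum>B\<in>?P. card B)"
    using residue_class_fall_coloring[OF n r dvd] partition_on_sum_card[of "{..<n}" ?P]
    unfolding injective_fall_coloring_def by simp
  moreover have "(\<Sum>B\<in>?P. ?\<rho>) = r * ?\<rho>"
    using inj_on_residue_class[OF n r dvd] by (simp add: card_image)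
  moreover have le: "card B \<le> ?\<rho>" if "B \<in> ?P" for B
    using open_packing_number_ge[OF _ op[OF that]] by simp
  moreover have "(\<Sum>B\<in>?P. card B) \<le> (\<Sum>B\<in>?P. ?\<rho>)"
    by (rule sum_mono) (rule le)
  ultimately have eq: "(\<Sum>B\<in>?P. card B) = (\<Sum>B\<in>?P. ?\<rho>)"
    using bound by linarith
  show "card B = ?\<rho>" if "B \<in> ?P" for B
    by (rule sum_mono_inv[OF eq le that]) auto
qed

lemma perfect_cycle_iff:
  assumes n: "n \<ge> 4" "even n"
  shows "perfect_injectively_colorable (cycle_graph n) \<longleftrightarrow> n mod 4 = 0 \<or> n = 6"
proof (cases "n mod 4 = 0")
  case True
  obtain B where "open_packing (cycle_graph n) B" "card B = open_packing_number (cycle_graph n)"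
    using open_packing_number_attained[of "cycle_graph n"] by auto
  then have "2 * open_packing_number (cycle_graph n) \<le> n"
    using open_packing_cycle_card(1)[of n B] n by auto
  then show ?thesis using perfect_cycle_if[of n 2] True n by auto
next
  case False
  then have "n mod 4 = 2" using n(2) by presburger
  then have "n = 4 * (n div 4) + 2" by presburger
  then obtain q where q: "n = 4 * q + 2" by blast
  then have q0: "q > 0" using n by auto
  note \<rho> = open_packing_number_cycle_odd_half[OF q q0]
  show ?thesis
  proof
    assume "perfect_injectively_colorable (cycle_graph n)"
    then obtain P where "partition_on {..<n} P" "\<And>B. B \<in> P \<Longrightarrow> card B = 2 * q"
      unfolding perfect_injectively_colorable_def injective_coloring_def
      using partition_on_color_classes[of "cycle_graph n"] \<rho> by fastforce
    then have "card P * (2 * q) = n"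
      using partition_on_sum_card[of "{..<n}" P] by simp
    \<comment> \<open>All classes have size \<open>2 * q\<close>; divisibility leaves only
      \<open>q = 1\<close>, that is \<open>n = 6\<close>.\<close>
    then have "2 * q dvd 4 * q + 2" using q by (metis dvd_triv_right)
    then have "2 * q dvd 2"
      using dvd_add_right_iff[of "2 * q" "4 * q" 2] by simp
    then show "n mod 4 = 0 \<or> n = 6" using q q0 by auto
  next
    assume "n mod 4 = 0 \<or> n = 6"
    then have "n = 6" using False by simp
    then show "perfect_injectively_colorable (cycle_graph n)"
      using perfect_cycle_if[of n 3] \<rho> q by simp
  qed
qed

section \<open>The injective chromatic number and the conclusion\<close>

text \<open>The case \<open>r = 3\<close> carries \<open>n mod 4 = 2\<close> because two colors
  suffice when 4 divides \<open>n\<close>. Otherwise, with two colors, having color 1 would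
  alternate along the shift.\<close>

lemma injective_chromatic_number_cycle:
  assumes n: "n \<ge> 3" and r: "r = 2 \<or> r = 3 \<and> n mod 4 = 2" and dvd: "2 * r dvd n"
  shows "injective_chromatic_number (cycle_graph n) = r"
  unfolding injective_chromatic_number_def
proof (rule Least_equality)
  show "\<exists>f. injective_coloring_fun (cycle_graph n) r f"
    using residue_coloring_fun[OF n _ dvd] r by blast
next
  fix k assume "\<exists>f. injective_coloring_fun (cycle_graph n) k f"
  then obtain f where f: "f ` {..<n} \<subseteq> {1..k}" "\<And>u. u < n \<Longrightarrow> f u \<noteq> f ((u + 2) mod n)"
    by (auto simp: injective_coloring_fun_cycle_iff[OF n])
  have range: "1 \<le> f u \<and> f u \<le> k" if "u < n" for u
    using f(1) that by (auto simp: image_subset_iff)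
  have lt: "(u + 2) mod n < n" for u using n by simp
  have "k \<noteq> 0" "k \<noteq> 1"
    using range[of 0] range[OF lt[of 0]] f(2)[of 0] n by auto
  moreover have False if k2: "k = 2" and n2: "n mod 4 = 2"
  proof -
    obtain u where "u < n" "f u = 1 \<longleftrightarrow> f ((u + 2) mod n) = 1"
      using not_alternating[OF n2, of "\<lambda>u. f u = 1"] by blast
    then show False using range[of u] range[OF lt[of u]] f(2)[of u] k2 by linarith
  qed
  ultimately have "k \<ge> 2" "n mod 4 = 2 \<longrightarrow> k \<noteq> 2" by auto
  then show "r \<le> k" using r by auto
qed

theorem proposition16:
  fixes n :: nat
  assumes "n \<ge> 4" and "even n"
  shows "(injectively_fall_colorable (cycle_graph n) \<longleftrightarrow>
            [n = 0] (mod 4) \<or> [n = 6] (mod 12)) \<and>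
         (perfect_injectively_colorable (cycle_graph n) \<longleftrightarrow>
            [n = 0] (mod 4) \<or> n = 6) \<and>
         (injectively_fall_chi_colorable (cycle_graph n) \<longleftrightarrow>
            [n = 0] (mod 4) \<or> [n = 6] (mod 12))"
proof -
  let ?G = "cycle_graph n"
  let ?C = "n mod 4 = 0 \<or> n mod 12 = 6"
  have n: "n \<ge> 3" using assms by simp
  have fall: ?C if "injectively_fall_colorable ?G"
  proof (cases "n mod 4 = 0")
    case False
    then have "n mod 4 = 2" using assms(2) by presburger
    then show ?thesis
      using that fall_colorable_cycle_imp[OF n] by (auto simp: injectively_fall_colorable_def)
  qed simp
  \<comment> \<open>This settles both converse directions, as such a coloring is in particular a
    fall coloring.\<close>
  have chi: "injectively_fall_chi_colorable ?G" if C: ?C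
  proof -
    \<comment> \<open>Two classes when 4 divides \<open>n\<close>; otherwise
      \<open>n mod 12 = 6\<close> makes \<open>n\<close> a multiple of 6 and allows three.\<close>
    obtain r where r: "r = 2 \<or> r = 3 \<and> n mod 4 = 2" "2 * r dvd n"
    proof (cases "n mod 4 = 0")
      case True
      then show ?thesis using that[of 2] by auto
    next
      case False
      then have "n mod 4 = 2" "6 dvd n" using C by presburger+
      then show ?thesis using that[of 3] by auto
    qed
    then have r': "r = 2 \<or> r = 3" by blast
    show ?thesis
      unfolding injectively_fall_chi_colorable_def
      using residue_class_fall_coloring[OF n r' r(2)] injective_chromatic_number_cycle[OF n r]
        card_image[OF inj_on_residue_class[OF n r' r(2)]]
      by (metis card_lessThan)
  qed
  have "injectively_fall_colorable ?G" if "injectively_fall_chi_colorable ?G"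
    using that by (auto simp: injectively_fall_colorable_def injectively_fall_chi_colorable_def)
  then show ?thesis
    using fall chi perfect_cycle_iff[OF assms] by (auto simp: cong_def)
qed

end
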